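(* For all integers $n$ and $t$, $$\sum_{j=1}^n F_{j+t}^6=\frac{F_{n+t}^5F_{n+t+3}-F_t^5F_{t+3}}{4}+\frac{F_{2n+2t}-F_{2t}}{4}$$ and $$\sum_{j=1}^n L_{j+t}^6=\frac{L_{n+t}^5L_{n+t+3}-L_t^5L_{t+3}}{4}+\frac{125\,(F_{2n+2t}-F_{2t})}{4}.$$
   Context: $F_k$ and $L_k$ ($k\in\mathbb Z$) are the Fibonacci and Lucas numbers: $F_0=0$, $F_1=1$, $L_0=2$, $L_1=1$, both satisfying $X_k=X_{k-1}+X_{k-2}$ for all integers $k$ (extended to negative indices by this recurrence). For $n=0$ the sum $\sum_{j=1}^n a_j$ is $0$, and for $n<0$ it is understood as $\sum_{j=1}^n a_j=-\sum_{j=n+1}^{0}a_j$. *)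

theory Defs
  imports Complex_Main "HOL-Number_Theory.Fib"
begin

text \<open>For negative indices the recurrence is run backwards, \<open>X k = X (k + 2) - X (k + 1)\<close>.
  The lemmas \<open>fibZ_rec\<close> and \<open>lucasZ_rec\<close> confirm the two-sided recurrence.\<close>

function fibZ :: "int \<Rightarrow> int" where
  "fibZ k = (if k = 0 then 0 else if k = 1 then 1
     else if k > 1 then fibZ (k - 1) + fibZ (k - 2)
     else fibZ (k + 2) - fibZ (k + 1))"
  by pat_completeness auto
termination
  by (relation "measure (\<lambda>k. nat (if k \<ge> 0 then k else 1 - k))") auto

function lucasZ :: "int \<Rightarrow> int" where
  "lucasZ k = (if k = 0 then 2 else if k = 1 then 1
     else if k > 1 then lucasZ (k - 1) + lucasZ (k - 2)
     else lucasZ (k + 2) - lucasZ (k + 1))"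
  by pat_completeness auto
termination
  by (relation "measure (\<lambda>k. nat (if k \<ge> 0 then k else 1 - k))") auto

declare fibZ.simps [simp del] lucasZ.simps [simp del]

lemma fibZ_0 [simp]: "fibZ 0 = 0" and fibZ_1 [simp]: "fibZ 1 = 1"
  by (simp_all add: fibZ.simps)

lemma lucasZ_0 [simp]: "lucasZ 0 = 2" and lucasZ_1 [simp]: "lucasZ 1 = 1"
  by (simp_all add: lucasZ.simps)

lemma fibZ_rec: "fibZ k = fibZ (k - 1) + fibZ (k - 2)"
proof (cases "k > 1")
  case True
  then show ?thesis by (subst fibZ.simps) simp
next
  case False
  then have "fibZ (k - 2) = fibZ k - fibZ (k - 1)"
    by (subst fibZ.simps) simp
  then show ?thesis by simp
qed

lemma lucasZ_rec: "lucasZ k = lucasZ (k - 1) + lucasZ (k - 2)"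
proof (cases "k > 1")
  case True
  then show ?thesis by (subst lucasZ.simps) simp
next
  case False
  then have "lucasZ (k - 2) = lucasZ k - lucasZ (k - 1)"
    by (subst lucasZ.simps) simp
  then show ?thesis by simp
qed

lemma fibZ_of_nat: "fibZ (int n) = int (fib n)"
proof (induction n rule: fib.induct)
  case (3 n)
  have "fibZ (int (Suc (Suc n))) = fibZ (int (Suc n)) + fibZ (int n)"
    by (subst fibZ_rec) (simp add: algebra_simps)
  then show ?case using 3 by simp
qed simp_all

text \<open>The sum of \<open>f j\<close> for \<open>j\<close> from \<open>1\<close> to \<open>n\<close>, with the signed convention for negative \<open>n\<close>.\<close>

definition sum_from_1 :: "(int \<Rightarrow> 'a::ab_group_add) \<Rightarrow> int \<Rightarrow> 'a" where
  "sum_from_1 f n = (if n \<ge> 0 then (\<Sum>j\<in>{1..n}. f j) else - (\<Sum>j\<in>{n + 1..0}. f j))"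

end

theory Submission
  imports Defs
begin

text \<open>Both sums telescope. Let \<open>x\<close> be a two-sided sequence with the Fibonacci recurrence and put
  \<open>a = x (k - 1)\<close>, \<open>b = x k\<close>. Then \<open>x (k + 3) = 3 b + 2 a\<close> and \<open>x (k + 2) = 2 b + a\<close>, and
  the polynomial identity
  \<open>4 b^6 = b^5 (3 b + 2 a) - a^5 (2 b + a) + (a\<^sup>2 + b\<^sup>2) (b\<^sup>2 - a b - a\<^sup>2)\<^sup>2\<close> holds.
  The quadratic form \<open>b\<^sup>2 - a b - a\<^sup>2\<close> only changes its sign when \<open>k\<close> moves by one (Cassini), so
  its square is a constant \<open>c\<^sup>2\<close>; and for the Fibonacci (\<open>c = 1\<close>) and Lucas (\<open>c = 5\<close>) numbers
  \<open>a\<^sup>2 + b\<^sup>2 = c * fibZ (2 * k - 1)\<close>, which is itself the difference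
  \<open>c * (fibZ (2 * k) - fibZ (2 * (k - 1)))\<close>. So \<open>4 * x k ^ 6\<close> is the backward difference of
  \<open>x k ^ 5 * x (k + 3) + c ^ 3 * fibZ (2 * k)\<close>; this gives the coefficients
  \<open>1\<close> and \<open>125\<close>.\<close>

lemma sum_from_1_0 [simp]: "sum_from_1 f 0 = 0"
  by (simp add: sum_from_1_def)

text \<open>The convention for negative upper limits is exactly what makes this step valid for every
  integer.\<close>

lemma sum_from_1_step: "sum_from_1 f (k + 1) = sum_from_1 f k + f (k + 1)"
proof -
  consider "k \<ge> 0" | "k = -1" | "k < -1" by linarith
  then show ?thesis
  proof cases
    case 1
    then have "{1..k + 1} = insert (k + 1) {1..k}" by auto
    with 1 show ?thesis by (simp add: sum_from_1_def add.commute)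
  next
    case 2
    then show ?thesis by (simp add: sum_from_1_def)
  next
    case 3
    then have "{k + 1..0} = insert (k + 1) {k + 2..0}" by auto
    with 3 show ?thesis by (simp add: sum_from_1_def add.commute)
  qed
qed

lemma sum_from_1_telescope:
  fixes f g :: "int \<Rightarrow> 'a::ring"
  assumes diff: "\<And>k. c * f k = g k - g (k - 1)"
  shows "c * sum_from_1 f n = g n - g 0"
proof (induction n rule: int_induct[where k = 0])
  case base
  show ?case by simp
next
  case (step1 i)
  then show ?case
    using diff[of "i + 1"] by (simp add: sum_from_1_step distrib_left)
next
  case (step2 i)
  have "c * sum_from_1 f (i - 1) = c * sum_from_1 f i - c * f i"
    using sum_from_1_step[of f "i - 1"] by (simp add: distrib_left)
  also have "\<dots> = g (i - 1) - g 0"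
    unfolding step2.IH diff[of i] by simp
  finally show ?case .
qed

text \<open>Cassini's identity in squared form, which removes the alternating sign.\<close>

lemma cassini_square:
  fixes x :: "int \<Rightarrow> 'a::comm_ring_1"
  assumes rec: "\<And>k. x k = x (k - 1) + x (k - 2)"
  shows "(x k ^ 2 - x (k - 1) * x k - x (k - 1) ^ 2) ^ 2 =
    (x 1 ^ 2 - x 0 * x 1 - x 0 ^ 2) ^ 2"
proof -
  define e where "e k = x k ^ 2 - x (k - 1) * x k - x (k - 1) ^ 2" for k
  have flip: "e (k + 1) = - e k" for k
    using rec[of "k + 1"] by (simp add: e_def power2_eq_square algebra_simps)
  have "e k ^ 2 = e 1 ^ 2"
  proof (induction k rule: int_induct[where k = 1])
    case (step1 i)
    then show ?case by (simp add: flip)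
  next
    case (step2 i)
    then show ?case using flip[of "i - 1"] by simp
  qed simp
  then show ?thesis by (simp add: e_def)
qed

text \<open>The second conjunct is what makes the induction close: together the two quadratic forms
  satisfy the recurrence of \<open>fibZ (2 * k - 1)\<close> and \<open>fibZ (2 * k)\<close>. The hypothesis \<open>init\<close> is the
  case \<open>k = 1\<close>.\<close>

lemma double_index:
  fixes x :: "int \<Rightarrow> int"
  assumes rec: "\<And>k. x k = x (k - 1) + x (k - 2)"
    and init: "x 0 ^ 2 + x 1 ^ 2 = c" "x 1 ^ 2 + 2 * x 0 * x 1 = c"
  shows "x (k - 1) ^ 2 + x k ^ 2 = c * fibZ (2 * k - 1) \<and>
    x k ^ 2 + 2 * x (k - 1) * x k = c * fibZ (2 * k)"
proof (induction k rule: int_induct[where k = 1])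
  case base
  show ?case using init fibZ_rec[of 2] by simp
next
  case (step1 i)
  have "x (i + 1) = x i + x (i - 1)"
    using rec[of "i + 1"] by simp
  moreover have "fibZ (2 * i + 1) = fibZ (2 * i) + fibZ (2 * i - 1)"
    using fibZ_rec[of "2 * i + 1"] by simp
  moreover have "fibZ (2 * i + 2) = fibZ (2 * i + 1) + fibZ (2 * i)"
    using fibZ_rec[of "2 * i + 2"] by (simp add: add.commute)
  ultimately show ?case
    using step1.IH by (simp add: power2_eq_square algebra_simps)
next
  case (step2 i)
  have x2: "x (i - 2) = x i - x (i - 1)"
    using rec[of i] by simp
  have f2: "fibZ (2 * i - 2) = fibZ (2 * i) - fibZ (2 * i - 1)"
    using fibZ_rec[of "2 * i"] by simp
  have f3: "fibZ (2 * i - 3) = 2 * fibZ (2 * i - 1) - fibZ (2 * i)"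
    using fibZ_rec[of "2 * i - 1"] f2 by simp
  have "x (i - 2) ^ 2 + x (i - 1) ^ 2 = c * fibZ (2 * i - 3)"
    unfolding x2 f3 using step2.IH by algebra
  moreover have "x (i - 1) ^ 2 + 2 * x (i - 2) * x (i - 1) = c * fibZ (2 * i - 2)"
    unfolding x2 f2 using step2.IH by algebra
  ultimately show ?case by simp
qed

lemma sum_sixth_powers:
  fixes x :: "int \<Rightarrow> int"
  assumes rec: "\<And>k. x k = x (k - 1) + x (k - 2)"
    and init: "x 0 ^ 2 + x 1 ^ 2 = c" "x 1 ^ 2 + 2 * x 0 * x 1 = c"
    and norm: "(x 1 ^ 2 - x 0 * x 1 - x 0 ^ 2) ^ 2 = c ^ 2"
  shows "4 * sum_from_1 (\<lambda>j. x (j + t) ^ 6) n =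
    x (n + t) ^ 5 * x (n + t + 3) - x t ^ 5 * x (t + 3)
    + c ^ 3 * (fibZ (2 * n + 2 * t) - fibZ (2 * t))"
proof -
  define g where "g k = x k ^ 5 * x (k + 3) + c ^ 3 * fibZ (2 * k)" for k
  have diff: "4 * x k ^ 6 = g k - g (k - 1)" for k
  proof -
    define a b where "a = x (k - 1)" and "b = x k"
    have x1: "x (k + 1) = b + a"
      using rec[of "k + 1"] by (simp add: a_def b_def)
    have x2: "x (k + 2) = 2 * b + a"
      using rec[of "k + 2"] x1 by (simp add: b_def add.commute)
    have x3: "x (k + 3) = 3 * b + 2 * a"
      using rec[of "k + 3"] x1 x2 by (simp add: add.commute)
    have "c ^ 3 * (fibZ (2 * k) - fibZ (2 * (k - 1))) = c ^ 2 * (c * fibZ (2 * k - 1))"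
      using fibZ_rec[of "2 * k"] by (simp add: power2_eq_square power3_eq_cube algebra_simps)
    also have "\<dots> = (b ^ 2 - a * b - a ^ 2) ^ 2 * (a ^ 2 + b ^ 2)"
      using double_index[of x c k, OF rec init] cassini_square[of x k, OF rec] norm
      by (simp add: a_def b_def)
    finally have "g k - g (k - 1) = b ^ 5 * (3 * b + 2 * a) - a ^ 5 * (2 * b + a)
        + (b ^ 2 - a * b - a ^ 2) ^ 2 * (a ^ 2 + b ^ 2)"
      using x2 x3 by (simp add: g_def a_def b_def algebra_simps)
    also have "\<dots> = 4 * b ^ 6"
      by algebra
    finally show ?thesis by (simp add: b_def)
  qed
  have "4 * sum_from_1 (\<lambda>j. x (j + t) ^ 6) n = g (n + t) - g (0 + t)"
  proof (rule sum_from_1_telescope)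
    show "4 * x (k + t) ^ 6 = g (k + t) - g (k - 1 + t)" for k
      using diff[of "k + t"] by (simp add: algebra_simps)
  qed
  then show ?thesis by (simp add: g_def algebra_simps)
qed

theorem mainTheorem2:
  fixes n t :: int
  shows "real_of_int (sum_from_1 (\<lambda>j. fibZ (j + t) ^ 6) n) =
      real_of_int (fibZ (n + t) ^ 5 * fibZ (n + t + 3) - fibZ t ^ 5 * fibZ (t + 3)) / 4
      + real_of_int (fibZ (2 * n + 2 * t) - fibZ (2 * t)) / 4
    \<and> real_of_int (sum_from_1 (\<lambda>j. lucasZ (j + t) ^ 6) n) =
      real_of_int (lucasZ (n + t) ^ 5 * lucasZ (n + t + 3) - lucasZ t ^ 5 * lucasZ (t + 3)) / 4
      + real_of_int (125 * (fibZ (2 * n + 2 * t) - fibZ (2 * t))) / 4"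
proof -
  have quarter: "real_of_int s = real_of_int p / 4 + real_of_int q / 4"
    if "4 * s = p + q" for s p q :: int
    using arg_cong[OF that, of real_of_int] by simp
  show ?thesis
    using sum_sixth_powers[of fibZ 1 t n, OF fibZ_rec]
      sum_sixth_powers[of lucasZ 5 t n, OF lucasZ_rec]
    by (intro conjI quarter) simp_all
qed

end
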